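(* Let $\alpha\in(0,1)$, let $P_k(y)$, $k\in[K]$, be the cross-conformal p-value functions built from $K$ folds of equal size $m=n/K$ and a symmetric score function $s$ as defined in the context, let $U$ be a uniform random variable on $(0,1)$ independent of all the data, and let $$\hat C^{\mathrm{mod\text{-}cross}}_{n,K,\alpha}(X_{n+1})=\Big\{y\in\mathcal Y:\ \frac1K\sum_{k=1}^K P_k(y)>\alpha\Big\},$$ $$\hat C^{\mathrm{e\text{-}mod\text{-}cross}}_{n,K,\alpha}(X_{n+1})=\Big\{y\in\mathcal Y:\ \min_{\ell\in[K]}\frac1\ell\sum_{k=1}^{\ell} P_k(y)>\alpha\Big\},$$ $$\hat C^{\mathrm{eu\text{-}mod\text{-}cross}}_{n,K,\alpha}(X_{n+1})=\Big\{y\in\mathcal Y:\ \min\Big\{\frac{1}{2-U}P_1(y),\ \min_{\ell\in[K]}\frac1\ell\sum_{k=1}^{\ell} P_k(y)\Big\}>\alpha\Big\}.$$ Then $\hat C^{\mathrm{eu\text{-}mod\text{-}cross}}_{n,K,\alpha}(X_{n+1})\subseteq \hat C^{\mathrm{e\text{-}mod\text{-}cross}}_{n,K,\alpha}(X_{n+1})\subseteq \hat C^{\mathrm{mod\text{-}cross}}_{n,K,\alpha}(X_{n+1})$. In addition, if the data $(X_1,Y_1),\dots,(X_{n+1},Y_{n+1})$ are exchangeable, then $$\mathbb P\big(Y_{n+1}\in \hat C^{\mathrm{eu\text{-}mod\text{-}cross}}_{n,K,\alpha}(X_{n+1})\big)\ge 1-2\alpha .$$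
   Context: Write $[d]=\{1,\dots,d\}$. Data points $Z_i=(X_i,Y_i)$, $i\in[n+1]$, are random elements of $\mathcal X\times\mathcal Y$ (measurable spaces); the first $n$ are training points and $(X_{n+1},Y_{n+1})$ is the test point. For $I\subseteq[n]$ let $\mathcal D_I=(Z_i: i\in I)$. Score function: $s((x,y);\mathcal D)\in\mathbb R$ is a (measurable) function defined for $(x,y)\in\mathcal X\times\mathcal Y$ and any finite dataset $\mathcal D\in\bigcup_{d\ge1}(\mathcal X\times\mathcal Y)^d$, and it is symmetric in the dataset: $s((x,y);\mathcal D)=s((x,y);\mathcal D^\pi)$ for every $\mathcal D\in(\mathcal X\times\mathcal Y)^d$ and every permutation $\pi$ of $[d]$, where $\mathcal D^\pi$ is $\mathcal D$ with its elements permuted by $\pi$. Folds: $[n]$ is partitioned into $K\ge2$ disjoint folds $I_1,\dots,I_K$ (chosen independently of the data), each of size $m=n/K$, which is assumed to be an integer. For $i\in[n]$, $k(i)$ is the index of the fold containing $i$, and $S_i^{\mathrm{CV}}=s\big((X_i,Y_i);\mathcal D_{[n]\setminus I_{k(i)}}\big)$. Cross-conformal p-values: for $k\in[K]$ and $y\in\mathcal Y$, $$P_k(y)=\frac{1+\sum_{i\in I_k}\mathbf 1\{s((X_{n+1},y);\mathcal D_{[n]\setminus I_k})\le S_i^{\mathrm{CV}}\}}{m+1}.$$ Exchangeable means that the joint distribution is invariant under every permutation of the indices. The probability is over all data $(X_1,Y_1),\dots,(X_{n+1},Y_{n+1})$ and $U$ (which is independent of the data and the folds). *)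

theory Defs
  imports "HOL-Probability.Probability" "HOL-Combinatorics.Permutations"
begin

text \<open>
  Datasets are lists, so a score has type \<open>'x \<times> 'y \<Rightarrow> ('x \<times> 'y) list \<Rightarrow> real\<close>; its value on the
  empty list is unconstrained. A dataset of length \<open>d\<close> corresponds to a point of the
  product space over \<open>{..<d}\<close>, which is what measurability refers to.
\<close>

definition measurable_score ::
  "'x measure \<Rightarrow> 'y measure \<Rightarrow> ('x \<times> 'y \<Rightarrow> ('x \<times> 'y) list \<Rightarrow> real) \<Rightarrow> bool" where
  "measurable_score MX MY s \<longleftrightarrow>
     (\<forall>d\<ge>1. (\<lambda>(z, D). s z (map D [0..<d]))
        \<in> borel_measurable ((MX \<Otimes>\<^sub>M MY) \<Otimes>\<^sub>M (\<Pi>\<^sub>M j\<in>{..<d}. MX \<Otimes>\<^sub>M MY)))"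

definition symmetric_score ::
  "'x measure \<Rightarrow> 'y measure \<Rightarrow> ('x \<times> 'y \<Rightarrow> ('x \<times> 'y) list \<Rightarrow> real) \<Rightarrow> bool" where
  "symmetric_score MX MY s \<longleftrightarrow>
     (\<forall>z\<in>space (MX \<Otimes>\<^sub>M MY). \<forall>D \<pi>.
        D \<noteq> [] \<longrightarrow> set D \<subseteq> space (MX \<Otimes>\<^sub>M MY) \<longrightarrow> \<pi> permutes {..<length D} \<longrightarrow>
        s z D = s z (permute_list \<pi> D))"

definition equal_folds :: "nat \<Rightarrow> nat \<Rightarrow> (nat \<Rightarrow> nat set) \<Rightarrow> bool" where
  "equal_folds n K I \<longleftrightarrow>
     (\<Union>k\<in>{1..K}. I k) = {1..n} \<and> disjoint_family_on I {1..K} \<and>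
     (\<forall>k\<in>{1..K}. card (I k) = n div K)"

definition fold_index :: "nat \<Rightarrow> (nat \<Rightarrow> nat set) \<Rightarrow> nat \<Rightarrow> nat" where
  "fold_index K I i = (THE k. k \<in> {1..K} \<and> i \<in> I k)"

definition dataset :: "(nat \<Rightarrow> 'x \<times> 'y) \<Rightarrow> nat set \<Rightarrow> ('x \<times> 'y) list" where
  "dataset z J = map z (sorted_list_of_set J)"

definition cv_score ::
  "('x \<times> 'y \<Rightarrow> ('x \<times> 'y) list \<Rightarrow> real) \<Rightarrow> nat \<Rightarrow> nat \<Rightarrow> (nat \<Rightarrow> nat set) \<Rightarrow>
   (nat \<Rightarrow> 'x \<times> 'y) \<Rightarrow> nat \<Rightarrow> real" where
  "cv_score s n K I z i = s (z i) (dataset z ({1..n} - I (fold_index K I i)))"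

text \<open>
  In the next definitions \<open>z\<close> is a realisation of the data, of which only the training points
  \<open>z 1, \<dots>, z n\<close> are used, and \<open>x\<close> is the test covariate.
\<close>

definition cross_pval ::
  "('x \<times> 'y \<Rightarrow> ('x \<times> 'y) list \<Rightarrow> real) \<Rightarrow> nat \<Rightarrow> nat \<Rightarrow> (nat \<Rightarrow> nat set) \<Rightarrow>
   (nat \<Rightarrow> 'x \<times> 'y) \<Rightarrow> 'x \<Rightarrow> nat \<Rightarrow> 'y \<Rightarrow> real" where
  "cross_pval s n K I z x k y =
     (1 + (\<Sum>i\<in>I k. of_bool (s (x, y) (dataset z ({1..n} - I k)) \<le> cv_score s n K I z i)))
     / (real (n div K) + 1)"

definition mod_cross_set ::
  "'y measure \<Rightarrow> ('x \<times> 'y \<Rightarrow> ('x \<times> 'y) list \<Rightarrow> real) \<Rightarrow> nat \<Rightarrow> nat \<Rightarrow> real \<Rightarrow>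
   (nat \<Rightarrow> nat set) \<Rightarrow> (nat \<Rightarrow> 'x \<times> 'y) \<Rightarrow> 'x \<Rightarrow> 'y set" where
  "mod_cross_set MY s n K \<alpha> I z x =
     {y \<in> space MY. (1 / real K) * (\<Sum>k=1..K. cross_pval s n K I z x k y) > \<alpha>}"

definition e_mod_cross_set ::
  "'y measure \<Rightarrow> ('x \<times> 'y \<Rightarrow> ('x \<times> 'y) list \<Rightarrow> real) \<Rightarrow> nat \<Rightarrow> nat \<Rightarrow> real \<Rightarrow>
   (nat \<Rightarrow> nat set) \<Rightarrow> (nat \<Rightarrow> 'x \<times> 'y) \<Rightarrow> 'x \<Rightarrow> 'y set" where
  "e_mod_cross_set MY s n K \<alpha> I z x =
     {y \<in> space MY.
        (MIN l\<in>{1..K}. (1 / real l) * (\<Sum>k=1..l. cross_pval s n K I z x k y)) > \<alpha>}"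

definition eu_mod_cross_set ::
  "'y measure \<Rightarrow> ('x \<times> 'y \<Rightarrow> ('x \<times> 'y) list \<Rightarrow> real) \<Rightarrow> nat \<Rightarrow> nat \<Rightarrow> real \<Rightarrow>
   (nat \<Rightarrow> nat set) \<Rightarrow> real \<Rightarrow> (nat \<Rightarrow> 'x \<times> 'y) \<Rightarrow> 'x \<Rightarrow> 'y set" where
  "eu_mod_cross_set MY s n K \<alpha> I u z x =
     {y \<in> space MY.
        min ((1 / (2 - u)) * cross_pval s n K I z x 1 y)
            (MIN l\<in>{1..K}. (1 / real l) * (\<Sum>k=1..l. cross_pval s n K I z x k y)) > \<alpha>}"

text \<open>
  Finite families of random elements, viewed as single random elements of product spaces.
  The restriction is required for membership in the (extensional) space of \<open>Pi\<^sub>M\<close>.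
\<close>

definition joint :: "'i set \<Rightarrow> ('i \<Rightarrow> 'w \<Rightarrow> 'a) \<Rightarrow> 'w \<Rightarrow> 'i \<Rightarrow> 'a" where
  "joint J V \<omega> = (\<lambda>i\<in>J. V i \<omega>)"

definition exchangeable :: "'w measure \<Rightarrow> 'a measure \<Rightarrow> 'i set \<Rightarrow> ('i \<Rightarrow> 'w \<Rightarrow> 'a) \<Rightarrow> bool" where
  "exchangeable M N J V \<longleftrightarrow>
     (\<forall>\<pi>. \<pi> permutes J \<longrightarrow>
        distr M (\<Pi>\<^sub>M i\<in>J. N) (joint J (\<lambda>i. V (\<pi> i))) = distr M (\<Pi>\<^sub>M i\<in>J. N) (joint J V))"

text \<open>
  The space of fold systems: each fold is an element of the finite discrete space of
  subsets of \<open>{1..n}\<close>.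
\<close>

definition fold_space :: "nat \<Rightarrow> nat \<Rightarrow> (nat \<Rightarrow> nat set) measure" where
  "fold_space n K = (\<Pi>\<^sub>M k\<in>{1..K}. count_space (Pow {1..n}))"

text \<open>
  The library's \<open>indep_var\<close> forces both random variables to have values of the same type;
  this is the same notion (independence of the generated sigma-algebras, through the library's
  \<open>indep_set\<close>) without that restriction.
\<close>

definition indep_rvs ::
  "'w measure \<Rightarrow> 'a measure \<Rightarrow> ('w \<Rightarrow> 'a) \<Rightarrow> 'b measure \<Rightarrow> ('w \<Rightarrow> 'b) \<Rightarrow> bool" where
  "indep_rvs M N f N' g \<longleftrightarrow>
     f \<in> M \<rightarrow>\<^sub>M N \<and> g \<in> M \<rightarrow>\<^sub>M N' \<and>
     prob_space.indep_set M {f -` A \<inter> space M |A. A \<in> sets N} {g -` B \<inter> space M |B. B \<in> sets N'}"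

end

(*
  With the folds fixed, permuting the training points so as to interchange two folds interchanges
  the two p-values, so P_1, ..., P_K are exchangeable. Exchanging the test point with points of one
  fold shows that P_k is distributed like a normalised rank, hence (1 - P_k / (2 alpha))_+ has
  expectation at most alpha. If a running average of the P_k is at most alpha, then the running
  average of these variables is at least 1/2; if P_1 / (2 - U) is at most alpha, then the first
  of them is at least U / 2. An exchangeable Markov inequality for running averages, in which the
  uniform variable randomises the first term, bounds the probability of this by 2 alpha.
  Finally one integrates over the independent folds.
*)
theory Submission
  imports Defs
begin

section \<open>Deterministic bounds for sums over ranks\<close>

text \<open>The induction removes a minimiser \<open>a\<close> of \<open>v\<close>. Its count is all
  of \<open>S\<close>, which gives the last summand; for the other points the counts within
  \<open>S - {a}\<close> are no larger, so \<open>g\<close> can only grow. Without ties there is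
  equality, and ties only increase the counts.\<close>

lemma sum_antimono_rank_le:
  fixes v :: "'a \<Rightarrow> 'b::linorder" and g :: "nat \<Rightarrow> real"
  assumes "finite S" and "antimono g"
  shows "(\<Sum>i\<in>S. g (card {j\<in>S. v i \<le> v j})) \<le> (\<Sum>r=1..card S. g r)"
  using assms(1)
proof (induction "card S" arbitrary: S)
  case 0
  then show ?case by simp
next
  case (Suc N)
  then have fin: "finite S" and ne: "S \<noteq> {}" by auto
  obtain a where a: "a \<in> S" "\<And>j. j \<in> S \<Longrightarrow> v a \<le> v j"
    using ex_min_if_finite[of "v ` S"] fin ne by (auto simp: not_less)
  let ?T = "S - {a}"
  have cT: "N = card ?T" using Suc a fin by simp
  have "{j\<in>S. v a \<le> v j} = S" using a by auto
  then have "(\<Sum>i\<in>S. g (card {j\<in>S. v i \<le> v j})) =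
      g (card S) + (\<Sum>i\<in>?T. g (card {j\<in>S. v i \<le> v j}))"
    using sum.remove[OF fin a(1), of "\<lambda>i. g (card {j\<in>S. v i \<le> v j})"] by simp
  also have "\<dots> \<le> g (card S) + (\<Sum>i\<in>?T. g (card {j\<in>?T. v i \<le> v j}))"
    by (intro add_left_mono sum_mono antimonoD[OF assms(2)] card_mono) (use fin in auto)
  also have "\<dots> \<le> g (card S) + (\<Sum>r=1..card ?T. g r)"
    using Suc.hyps(1)[OF cT] fin by simp
  also have "\<dots> = (\<Sum>r=1..card S. g r)"
    using Suc.hyps(2)[symmetric] cT by simp
  finally show ?case .
qed

text \<open>Only the indices \<open>r\<close> up to \<open>t\<close> contribute, and summing the
  arithmetic progression leaves a quadratic in their number \<open>f\<close>. It is applied with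
  \<open>t\<close> equal to \<open>2 * \<alpha>\<close> times the number of ranks.\<close>

lemma sum_pos_part_linear_le:
  fixes t :: real
  assumes "t > 0"
  shows "(\<Sum>r=1..N. max 0 (1 - real r / t)) \<le> t / 2"
proof -
  define f where "f = min N (nat \<lfloor>t\<rfloor>)"
  have "(\<Sum>r=1..N. max 0 (1 - real r / t)) = (\<Sum>r=1..f. 1 - real r / t)"
  proof (rule sum.mono_neutral_cong_right)
    show "\<forall>r\<in>{1..N} - {1..f}. max 0 (1 - real r / t) = 0"
    proof
      fix r assume "r \<in> {1..N} - {1..f}"
      then have "nat \<lfloor>t\<rfloor> < r" by (auto simp: f_def)
      then have "t \<le> real r" using assms by linarith
      then show "max 0 (1 - real r / t) = 0" using assms by (simp add: max_def field_simps)
    qed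
    fix r assume "r \<in> {1..f}"
    then have "real r \<le> t" using assms by (auto simp: f_def le_nat_iff le_floor_iff)
    then show "max 0 (1 - real r / t) = 1 - real r / t" using assms by simp
  qed (auto simp: f_def)
  also have "\<dots> = real f - (\<Sum>r=1..f. real r) / t"
    by (simp add: sum_subtractf sum_divide_distrib)
  also have "(\<Sum>r=1..f. real r) = real f * (real f + 1) / 2"
    by (induction f) (auto simp: field_simps)
  also have "real f - real f * (real f + 1) / 2 / t \<le> t / 2"
  proof -
    \<comment> \<open>This is the claim multiplied by \<open>2 * t\<close> and rearranged.\<close>
    have "0 \<le> (t - real f)\<^sup>2 + real f" by simp
    then show ?thesis using assms by (simp add: field_simps power2_eq_square)
  qed
  finally show ?thesis .
qed

section \<open>A Markov inequality for running averages of exchangeable variables\<close>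

text \<open>The event \<open>B\<close> is split by the last time at which the average is at least
  \<open>c\<close>; on each piece all variables up to that time have the same integral as
  \<open>f 1\<close>, so \<open>f 1\<close> can replace the average. Exchangeability enters through
  measure-preserving maps that realise the transpositions of 1 and \<open>j\<close>. Keeping the
  indicator of \<open>B\<close> on the right leaves the mass of \<open>f 1\<close> outside
  \<open>B\<close> available for the randomisation by \<open>U\<close>.\<close>

lemma (in finite_measure) exchangeable_markov:
  fixes f :: "nat \<Rightarrow> 'a \<Rightarrow> real" and c :: real
  assumes int: "\<And>k. k \<in> {1..K} \<Longrightarrow> integrable M (f k)"
    and swap: "\<And>j. j \<in> {1..K} \<Longrightarrow> \<exists>T \<in> M \<rightarrow>\<^sub>M M. distr M M T = M \<and>
      (\<forall>z\<in>space M. \<forall>k\<in>{1..K}. f k (T z) = f (Transposition.transpose 1 j k) z)"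
  defines "B \<equiv> {z\<in>space M. \<exists>l\<in>{1..K}. c \<le> (1 / real l) * (\<Sum>k=1..l. f k z)}"
  shows "c * measure M B \<le> (\<integral>z. f 1 z * indicator B z \<partial>M)"
proof -
  define A where "A l z = (1 / real l) * (\<Sum>k=1..l. f k z)" for l z
  \<comment> \<open>\<open>D l\<close>: the last time the running average is at least \<open>c\<close> is \<open>l\<close>.
    This event is symmetric in the first \<open>l\<close> variables.\<close>
  define D where "D l = {z\<in>space M. c \<le> A l z \<and> (\<forall>l'\<in>{l<..K}. A l' z < c)}" for l
  have f_meas: "f k \<in> borel_measurable M" if "k \<in> {1..K}" for k
    using int[OF that] by auto
  have A_meas: "A l \<in> borel_measurable M" if "l \<in> {1..K}" for l
    unfolding A_def using that by (intro borel_measurable_times borel_measurable_sum f_meas) auto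
  have D_sets: "D l \<in> sets M" if "l \<in> {1..K}" for l
  proof -
    note A_meas[OF that, measurable]
    have [measurable]: "\<And>l'. l' \<in> {l<..K} \<Longrightarrow> A l' \<in> borel_measurable M"
      using that by (intro A_meas) auto
    show ?thesis unfolding D_def by measurable
  qed
  have BD: "B = (\<Union>l\<in>{1..K}. D l)"
  proof (intro set_eqI iffI)
    fix z assume "z \<in> B"
    then have z: "z \<in> space M" and ex: "\<exists>l. l \<in> {1..K} \<and> c \<le> A l z"
      by (auto simp: B_def A_def)
    define l where "l = Max {l \<in> {1..K}. c \<le> A l z}"
    have "l \<in> {l \<in> {1..K}. c \<le> A l z}"
      unfolding l_def by (rule Max_in) (use ex in auto)
    moreover have "A l' z < c" if l': "l' \<in> {l<..K}" for l'
    proof (rule ccontr)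
      assume "\<not> A l' z < c"
      then have "l' \<le> l" unfolding l_def using l' calculation by (intro Max_ge) auto
      then show False using l' by auto
    qed
    ultimately show "z \<in> (\<Union>l\<in>{1..K}. D l)" using z by (auto simp: D_def)
  next
    fix z assume "z \<in> (\<Union>l\<in>{1..K}. D l)"
    then show "z \<in> B" by (auto simp: D_def B_def A_def)
  qed
  have disj: "disjoint_family_on D {1..K}"
    unfolding disjoint_family_on_def
  proof (intro ballI impI)
    fix a b assume ab: "a \<in> {1..K}" "b \<in> {1..K}" "a \<noteq> b"
    show "D a \<inter> D b = {}"
    proof (rule ccontr)
      assume "D a \<inter> D b \<noteq> {}"
      then obtain z where z: "z \<in> D a" "z \<in> D b" by auto
      from ab consider "b \<in> {a<..K}" | "a \<in> {b<..K}" by fastforce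
      then show False using z by cases (force simp: D_def)+
    qed
  qed
  have int_ind: "integrable M (\<lambda>z. f k z * indicator (D l) z)" if "k \<in> {1..K}" "l \<in> {1..K}" for k l
    using integrable_real_mult_indicator[OF D_sets[OF that(2)] int[OF that(1)]] by simp
  have exch: "(\<integral>z. f j z * indicator (D l) z \<partial>M) = (\<integral>z. f 1 z * indicator (D l) z \<partial>M)"
    if l: "l \<in> {1..K}" and j: "j \<in> {1..l}" for j l
  proof -
    have jK: "j \<in> {1..K}" using l j by auto
    obtain T where T[measurable]: "T \<in> M \<rightarrow>\<^sub>M M" and dT: "distr M M T = M"
      and fT: "\<And>z k. z \<in> space M \<Longrightarrow> k \<in> {1..K} \<Longrightarrow> f k (T z) = f (Transposition.transpose 1 j k) z"
      using swap[OF jK] by blast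
    \<comment> \<open>Both 1 and \<open>j\<close> lie in \<open>{1..l'}\<close>, so the
      transposition only reorders the sum. As \<open>D l\<close> involves only averages from time
      \<open>l\<close> on, it is invariant under \<open>T\<close>; an event defined by the first
      such time would not be.\<close>
    have AT: "A l' (T z) = A l' z" if "l' \<in> {l..K}" "z \<in> space M" for l' z
    proof -
      have "(\<Sum>k=1..l'. f k (T z)) = (\<Sum>k=1..l'. f (Transposition.transpose 1 j k) z)"
        using that l j by (intro sum.cong fT) auto
      also have "\<dots> = (\<Sum>k=1..l'. f k z)"
        using sum.permute[OF permutes_swap_id[of 1 "{1..l'}" j], of "\<lambda>k. f k z"] that j
        by (auto simp: o_def)
      finally show ?thesis by (simp add: A_def)
    qed
    have DT: "T z \<in> D l \<longleftrightarrow> z \<in> D l" if "z \<in> space M" for z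
      using that AT[of _ z] l measurable_space[OF T that] by (auto simp: D_def)
    have "(\<integral>z. f 1 z * indicator (D l) z \<partial>M) = (\<integral>z. f 1 z * indicator (D l) z \<partial>distr M M T)"
      by (simp add: dT)
    also have "\<dots> = (\<integral>z. f 1 (T z) * indicator (D l) (T z) \<partial>M)"
      using int_ind[of 1 l] l by (intro integral_distr) auto
    also have "\<dots> = (\<integral>z. f j z * indicator (D l) z \<partial>M)"
      using l DT fT[of _ 1] by (intro Bochner_Integration.integral_cong) (auto simp: indicator_def)
    finally show ?thesis by simp
  qed
  have step: "c * measure M (D l) \<le> (\<integral>z. f 1 z * indicator (D l) z \<partial>M)" if l: "l \<in> {1..K}" for l
  proof -
    have eq: "A l z * indicator (D l) z = (1 / real l) * (\<Sum>k=1..l. f k z * indicator (D l) z)" for z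
      by (simp add: A_def sum_distrib_right)
    have intA: "integrable M (\<lambda>z. A l z * indicator (D l) z)"
      unfolding eq using l
      by (intro integrable_mult_right Bochner_Integration.integrable_sum int_ind) auto
    have "c * measure M (D l) = (\<integral>z. c * indicator (D l) z \<partial>M)"
      using D_sets[OF l] by simp
    also have "\<dots> \<le> (\<integral>z. A l z * indicator (D l) z \<partial>M)"
    proof (rule integral_mono[OF _ intA])
      show "integrable M (\<lambda>z. c * indicator (D l) z)"
        using integrable_real_mult_indicator[OF D_sets[OF l] integrable_const[of c]]
        by (simp add: mult.commute)
    qed (auto simp: D_def indicator_def)
    also have "\<dots> = (1 / real l) * (\<Sum>k=1..l. (\<integral>z. f k z * indicator (D l) z \<partial>M))"
    proof -
      have "(\<integral>z. (\<Sum>k=1..l. f k z * indicator (D l) z) \<partial>M) =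
          (\<Sum>k=1..l. (\<integral>z. f k z * indicator (D l) z \<partial>M))"
        by (rule Bochner_Integration.integral_sum) (use l in \<open>auto intro: int_ind\<close>)
      then show ?thesis by (simp only: eq integral_mult_right_zero)
    qed
    also have "(\<Sum>k=1..l. (\<integral>z. f k z * indicator (D l) z \<partial>M)) =
        (\<Sum>k=1..l. (\<integral>z. f 1 z * indicator (D l) z \<partial>M))"
      by (intro sum.cong refl exch[OF l])
    also have "(1 / real l) * \<dots> = (\<integral>z. f 1 z * indicator (D l) z \<partial>M)"
      using l by simp
    finally show ?thesis .
  qed
  have "c * measure M B = (\<Sum>l=1..K. c * measure M (D l))"
    unfolding BD using disj D_sets
    by (subst finite_measure_finite_Union) (auto simp: sum_distrib_left)
  also have "\<dots> \<le> (\<Sum>l=1..K. (\<integral>z. f 1 z * indicator (D l) z \<partial>M))"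
    by (intro sum_mono step)
  also have "\<dots> = (\<integral>z. (\<Sum>l=1..K. f 1 z * indicator (D l) z) \<partial>M)"
    using int_ind by (subst Bochner_Integration.integral_sum) auto
  also have "\<dots> = (\<integral>z. f 1 z * indicator B z \<partial>M)"
    unfolding BD
    by (subst indicator_UN_disjoint[OF _ disj]) (simp_all add: sum_distrib_left)
  finally show ?thesis .
qed

section \<open>Product laws from independence\<close>

text \<open>Rectangles determine the product of sigma-finite measures, and on a rectangle the
  preimage is an intersection whose probability factors by independence.\<close>

lemma (in prob_space) indep_rvs_distr_Pair:
  assumes "indep_rvs M N f N' g"
  shows "distr M (N \<Otimes>\<^sub>M N') (\<lambda>\<omega>. (f \<omega>, g \<omega>)) = distr M N f \<Otimes>\<^sub>M distr M N' g"
proof -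
  have f[measurable]: "f \<in> M \<rightarrow>\<^sub>M N" and g[measurable]: "g \<in> M \<rightarrow>\<^sub>M N'"
    and ind: "indep_set {f -` A \<inter> space M |A. A \<in> sets N} {g -` B \<inter> space M |B. B \<in> sets N'}"
    using assms by (auto simp: indep_rvs_def)
  interpret f: prob_space "distr M N f" by (rule prob_space_distr) simp
  interpret g: prob_space "distr M N' g" by (rule prob_space_distr) simp
  show ?thesis
  proof (rule pair_measure_eqI[symmetric])
    show "sigma_finite_measure (distr M N f)" "sigma_finite_measure (distr M N' g)"
      by unfold_locales
    show "sets (distr M N f \<Otimes>\<^sub>M distr M N' g) = sets (distr M (N \<Otimes>\<^sub>M N') (\<lambda>\<omega>. (f \<omega>, g \<omega>)))"
      by (subst sets_distr) (rule sets_pair_measure_cong; simp)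
    fix A B assume "A \<in> sets (distr M N f)" "B \<in> sets (distr M N' g)"
    then have [measurable]: "A \<in> sets N" "B \<in> sets N'" by auto
    have "prob ((f -` A \<inter> space M) \<inter> (g -` B \<inter> space M)) =
        prob (f -` A \<inter> space M) * prob (g -` B \<inter> space M)"
      by (rule indep_setD[OF ind]) auto
    moreover have "(\<lambda>\<omega>. (f \<omega>, g \<omega>)) -` (A \<times> B) \<inter> space M =
        (f -` A \<inter> space M) \<inter> (g -` B \<inter> space M)" by auto
    ultimately show "emeasure (distr M N f) A * emeasure (distr M N' g) B =
        emeasure (distr M (N \<Otimes>\<^sub>M N') (\<lambda>\<omega>. (f \<omega>, g \<omega>))) (A \<times> B)"
      by (simp add: emeasure_distr emeasure_eq_measure ennreal_mult')
  qed
qed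

section \<open>The p-value of a single fold under permutations of the data\<close>

text \<open>The cross-conformal p-value at the true test label. The test point is
  \<open>z (n+1)\<close> and the fold is a plain set, so that permutations of the indices act
  directly on the arguments.\<close>

definition fold_pval ::
  "('x \<times> 'y \<Rightarrow> ('x \<times> 'y) list \<Rightarrow> real) \<Rightarrow> nat \<Rightarrow> nat \<Rightarrow> nat set \<Rightarrow> (nat \<Rightarrow> 'x \<times> 'y) \<Rightarrow> real" where
  "fold_pval s n m F z =
     (1 + (\<Sum>i\<in>F. of_bool (s (z (n+1)) (dataset z ({1..n} - F)) \<le> s (z i) (dataset z ({1..n} - F)))))
     / (real m + 1)"

lemma fold_index_eq:
  assumes "equal_folds n K J" "k \<in> {1..K}" "i \<in> J k"
  shows "fold_index K J i = k"
  unfolding fold_index_def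
proof (rule the_equality)
  fix k' assume "k' \<in> {1..K} \<and> i \<in> J k'"
  then show "k' = k"
    using assms unfolding equal_folds_def disjoint_family_on_def by blast
qed (use assms in auto)

lemma cross_pval_eq_fold_pval:
  assumes "equal_folds n K J" "k \<in> {1..K}" "z (n+1) = (x, y)"
  shows "cross_pval s n K J z x k y = fold_pval s n (n div K) (J k) z"
  using assms(3) fold_index_eq[OF assms(1,2)]
  by (auto simp: cross_pval_def fold_pval_def cv_score_def intro!: sum.cong)

lemma dataset_cong:
  assumes "finite S" "\<And>i. i \<in> S \<Longrightarrow> z i = z' i"
  shows "dataset z S = dataset z' S"
  using assms by (simp add: dataset_def)

lemma fold_pval_cong:
  assumes "F \<subseteq> {1..n}" "\<And>i. i \<in> {1..n+1} \<Longrightarrow> z i = z' i"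
  shows "fold_pval s n m F z = fold_pval s n m F z'"
proof -
  have "dataset z ({1..n} - F) = dataset z' ({1..n} - F)"
    by (rule dataset_cong) (use assms in auto)
  moreover have "z i = z' i" if "i \<in> F" for i
    using assms that by auto
  ultimately show ?thesis
    using assms(2)[of "n+1"] by (simp add: fold_pval_def cong: sum.cong)
qed

lemma mset_dataset: "finite S \<Longrightarrow> mset (dataset z S) = image_mset z (mset_set S)"
  unfolding dataset_def mset_map by (metis mset_sorted_list_of_multiset sorted_list_of_mset_set)

text \<open>Lists with the same multiset differ by a permutation of positions. This absorbs the
  reordering that arises because \<open>dataset\<close> lists points by increasing index.\<close>

lemma symmetric_score_mset_cong:
  assumes "symmetric_score MX MY s" "p \<in> space (MX \<Otimes>\<^sub>M MY)" "set D \<subseteq> space (MX \<Otimes>\<^sub>M MY)"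
    and "mset D = mset D'"
  shows "s p D = s p D'"
proof (cases "D = []")
  case False
  obtain \<pi> where "\<pi> permutes {..<length D}" "permute_list \<pi> D = D'"
    using mset_eq_permutation[OF assms(4)[symmetric]] by metis
  then show ?thesis using assms False unfolding symmetric_score_def by metis
qed (use assms in auto)

text \<open>The permutation fixes the test index \<open>n+1\<close> and maps the complement of
  \<open>F\<close> onto the complement of its image, so the two training datasets agree as
  multisets. Permuting training points thus amounts to moving the fold.\<close>

lemma fold_pval_permute:
  assumes sym: "symmetric_score MX MY s" and z: "z \<in> space (\<Pi>\<^sub>M i\<in>{1..n+1}. MX \<Otimes>\<^sub>M MY)"
    and \<pi>: "\<pi> permutes {1..n}" and F: "F \<subseteq> {1..n}"
  shows "fold_pval s n m F (\<lambda>i\<in>{1..n+1}. z (\<pi> i)) = fold_pval s n m (\<pi> ` F) z"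
proof -
  let ?z = "\<lambda>i\<in>{1..n+1}. z (\<pi> i)"
  have inj: "inj \<pi>" using permutes_inj[OF \<pi>] .
  have \<pi>n: "\<pi> (n+1) = n+1" using permutes_not_in[OF \<pi>] by simp
  have zs: "z i \<in> space (MX \<Otimes>\<^sub>M MY)" if "i \<in> {1..n+1}" for i
    using z that unfolding space_PiM by (rule PiE_mem)
  have \<pi>in: "\<pi> i \<in> {1..n}" if "i \<in> {1..n}" for i using permutes_in_image[OF \<pi>] that by blast
  have compl: "\<pi> ` ({1..n} - F) = {1..n} - \<pi> ` F"
    using permutes_image[OF \<pi>] by (simp add: image_set_diff[OF inj])
  have "mset (dataset ?z ({1..n} - F)) = image_mset (\<lambda>i. z (\<pi> i)) (mset_set ({1..n} - F))"
    by (auto simp: mset_dataset intro!: image_mset_cong)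
  also have "\<dots> = image_mset z (image_mset \<pi> (mset_set ({1..n} - F)))"
    by (simp add: multiset.map_comp o_def)
  also have "image_mset \<pi> (mset_set ({1..n} - F)) = mset_set (\<pi> ` ({1..n} - F))"
    by (rule image_mset_mset_set[OF inj_on_subset[OF inj]]) simp
  also have "image_mset z \<dots> = mset (dataset z ({1..n} - \<pi> ` F))"
    by (simp only: compl mset_dataset finite_Diff finite_atLeastAtMost)
  finally have ms: "mset (dataset ?z ({1..n} - F)) = mset (dataset z ({1..n} - \<pi> ` F))" .
  have D: "set (dataset ?z ({1..n} - F)) \<subseteq> space (MX \<Otimes>\<^sub>M MY)"
  proof
    fix p assume "p \<in> set (dataset ?z ({1..n} - F))"
    then obtain i where "i \<in> {1..n}" "p = z (\<pi> i)"
      by (auto simp: dataset_def)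
    then show "p \<in> space (MX \<Otimes>\<^sub>M MY)" using zs[of "\<pi> i"] \<pi>in[of i] by auto
  qed
  have s_eq: "s (z i) (dataset ?z ({1..n} - F)) = s (z i) (dataset z ({1..n} - \<pi> ` F))"
    if "i \<in> {1..n+1}" for i
    by (rule symmetric_score_mset_cong[OF sym zs[OF that] D ms])
  have "(\<Sum>i\<in>F. of_bool (s (?z (n+1)) (dataset ?z ({1..n} - F)) \<le> s (?z i) (dataset ?z ({1..n} - F)))) =
    (\<Sum>i\<in>F. of_bool (s (z (n+1)) (dataset z ({1..n} - \<pi> ` F))
      \<le> s (z (\<pi> i)) (dataset z ({1..n} - \<pi> ` F))) :: real)"
  proof (rule sum.cong[OF refl])
    fix i assume "i \<in> F"
    then have i: "i \<in> {1..n}" using F by auto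
    have "?z i = z (\<pi> i)" "?z (n+1) = z (n+1)" using i \<pi>n by auto
    then show "of_bool (s (?z (n+1)) (dataset ?z ({1..n} - F)) \<le> s (?z i) (dataset ?z ({1..n} - F))) =
      (of_bool (s (z (n+1)) (dataset z ({1..n} - \<pi> ` F))
        \<le> s (z (\<pi> i)) (dataset z ({1..n} - \<pi> ` F))) :: real)"
      using s_eq[of "n+1"] s_eq[of "\<pi> i"] \<pi>in[OF i] by simp
  qed
  also have "\<dots> = (\<Sum>i\<in>\<pi> ` F. of_bool (s (z (n+1)) (dataset z ({1..n} - \<pi> ` F))
      \<le> s (z i) (dataset z ({1..n} - \<pi> ` F))))"
    by (simp add: sum.reindex[OF inj_on_subset[OF inj]])
  finally show ?thesis by (simp add: fold_pval_def)
qed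

text \<open>The swapped indices \<open>a\<close> and \<open>n+1\<close> both lie outside
  \<open>{1..n} - F\<close>, so the training data and hence the score function stay the same. The
  p-value becomes the normalised rank of \<open>a\<close> among the fold together with the test
  point.\<close>

lemma fold_pval_transpose:
  assumes F: "F \<subseteq> {1..n}" and a: "a \<in> insert (n+1) F"
  shows "fold_pval s n m F (\<lambda>i\<in>{1..n+1}. z (Transposition.transpose a (n+1) i)) =
    real (card {j\<in>insert (n+1) F. s (z a) (dataset z ({1..n} - F)) \<le> s (z j) (dataset z ({1..n} - F))})
      / (real m + 1)"
proof -
  let ?t = "Transposition.transpose a (n+1)"
  let ?z = "\<lambda>i\<in>{1..n+1}. z (?t i)"
  define \<sigma> where "\<sigma> j = s (z j) (dataset z ({1..n} - F))" for j
  have finF: "finite F" using F finite_subset by blast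
  have nF: "n+1 \<notin> F" using F by auto
  have aI: "a \<in> {1..n+1}" using a F by auto
  have "?t i = i" if "i \<in> {1..n} - F" for i
    using that a by (auto simp: Transposition.transpose_def)
  then have D: "dataset ?z ({1..n} - F) = dataset z ({1..n} - F)"
    by (intro dataset_cong) auto
  have zi: "s (?z i) (dataset ?z ({1..n} - F)) = \<sigma> (?t i)" if "i \<in> insert (n+1) F" for i
    using that F aI unfolding D \<sigma>_def by auto
  have img: "?t ` insert (n+1) F = insert (n+1) F"
    by (rule permutes_image[OF permutes_swap_id]) (use a in auto)
  \<comment> \<open>The leading 1 is the comparison of the test point with itself, the term
    \<open>i = n+1\<close>.\<close>
  have "1 + (\<Sum>i\<in>F. of_bool (s (?z (n+1)) (dataset ?z ({1..n} - F)) \<le> s (?z i) (dataset ?z ({1..n} - F)))) =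
     (\<Sum>i\<in>insert (n+1) F. of_bool (s (?z (n+1)) (dataset ?z ({1..n} - F)) \<le> s (?z i) (dataset ?z ({1..n} - F))) :: real)"
    using finF nF by (subst sum.insert) auto
  also have "\<dots> = (\<Sum>i\<in>insert (n+1) F. of_bool (\<sigma> a \<le> \<sigma> (?t i)))"
    by (intro sum.cong) (simp_all only: zi insertI1 Transposition.transpose_apply_second)
  also have "\<dots> = (\<Sum>i\<in>?t ` insert (n+1) F. of_bool (\<sigma> a \<le> \<sigma> i))"
    using sum.reindex[OF permutes_inj_on[OF permutes_swap_id[OF a insertI1]],
        of "\<lambda>i. of_bool (\<sigma> a \<le> \<sigma> i) :: real"] by (simp only: o_def)
  also have "\<dots> = real (card {j\<in>insert (n+1) F. \<sigma> a \<le> \<sigma> j})"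
    unfolding img using finF by (simp add: of_bool_def sum.If_cases Int_def)
  finally show ?thesis by (simp add: fold_pval_def \<sigma>_def)
qed

section \<open>Measurability of scores and p-values\<close>

text \<open>The map is the score on datasets of a fixed length composed with a selection of
  coordinates. The set \<open>S\<close> is nonempty because \<open>measurable_score\<close> speaks
  of lengths at least 1.\<close>

lemma measurable_score_dataset:
  assumes "measurable_score MX MY s" "i \<in> {1..n+1}" "S \<subseteq> {1..n}" "S \<noteq> {}"
  shows "(\<lambda>z. s (z i) (dataset z S)) \<in> borel_measurable (\<Pi>\<^sub>M i\<in>{1..n+1}. MX \<Otimes>\<^sub>M MY)"
proof -
  let ?P = "\<Pi>\<^sub>M i\<in>{1..n+1}. MX \<Otimes>\<^sub>M MY"
  define L where "L = sorted_list_of_set S"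
  have fin: "finite S" using assms finite_subset by blast
  have L: "length L \<ge> 1" "set L = S"
    using fin assms(4) by (simp_all add: L_def Suc_le_eq card_gt_0_iff)
  have nth: "L ! j \<in> {1..n+1}" if "j < length L" for j
    using that L(2) assms(3) nth_mem[of j L] by fastforce
  have pair: "(\<lambda>z. (z i, \<lambda>j\<in>{..<length L}. z (L ! j))) \<in>
      ?P \<rightarrow>\<^sub>M (MX \<Otimes>\<^sub>M MY) \<Otimes>\<^sub>M (\<Pi>\<^sub>M j\<in>{..<length L}. MX \<Otimes>\<^sub>M MY)"
    using assms(2) nth
    by (intro measurable_Pair measurable_restrict measurable_component_singleton) auto
  have sc: "(\<lambda>(z, D). s z (map D [0..<length L]))
      \<in> borel_measurable ((MX \<Otimes>\<^sub>M MY) \<Otimes>\<^sub>M (\<Pi>\<^sub>M j\<in>{..<length L}. MX \<Otimes>\<^sub>M MY))"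
    using assms(1) L(1) unfolding measurable_score_def by blast
  have "map (\<lambda>j\<in>{..<length L}. z (L ! j)) [0..<length L] = dataset z S" for z :: "nat \<Rightarrow> 'a \<times> 'b"
    unfolding dataset_def L_def[symmetric] by (rule nth_equalityI) auto
  then show ?thesis
    using measurable_compose[OF pair sc] by simp
qed

text \<open>For a nonempty fold the second condition on \<open>F\<close> keeps the training set
  nonempty. An empty fold, as for \<open>n = 0\<close>, gives a constant.\<close>

lemma measurable_fold_pval:
  assumes "measurable_score MX MY s" "F \<subseteq> {1..n}" "F \<noteq> {} \<Longrightarrow> F \<noteq> {1..n}"
  shows "fold_pval s n m F \<in> borel_measurable (\<Pi>\<^sub>M i\<in>{1..n+1}. MX \<Otimes>\<^sub>M MY)"
proof (cases "F = {}")
  case False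
  let ?P = "\<Pi>\<^sub>M i\<in>{1..n+1}. MX \<Otimes>\<^sub>M MY"
  have score: "(\<lambda>z. s (z i) (dataset z ({1..n} - F))) \<in> borel_measurable ?P"
    if "i \<in> insert (n+1) F" for i
    using that assms False by (intro measurable_score_dataset) auto
  have "(\<lambda>z. of_bool (s (z (n+1)) (dataset z ({1..n} - F)) \<le> s (z i) (dataset z ({1..n} - F))) :: real)
      \<in> borel_measurable ?P" if "i \<in> F" for i
  proof -
    show ?thesis
      using that unfolding of_bool_def
      by (intro measurable_If borel_measurable_const borel_measurable_le score) auto
  qed
  then show ?thesis unfolding fold_pval_def
    by (intro borel_measurable_divide borel_measurable_add borel_measurable_sum) auto
next
  case True
  then have "fold_pval s n m F = (\<lambda>_. 1 / (real m + 1))"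
    by (simp add: fold_pval_def fun_eq_iff)
  then show ?thesis by simp
qed

lemma fold_pval_nonneg: "0 \<le> fold_pval s n m F z"
  by (simp add: fold_pval_def sum_nonneg)

section \<open>Expectation of the calibrated p-value\<close>

definition permute_data :: "nat \<Rightarrow> (nat \<Rightarrow> nat) \<Rightarrow> (nat \<Rightarrow> 'a) \<Rightarrow> nat \<Rightarrow> 'a" where
  "permute_data n \<pi> z = (\<lambda>i\<in>{1..n+1}. z (\<pi> i))"

lemma measurable_permute_data:
  assumes "\<pi> permutes {1..n+1}"
  shows "permute_data n \<pi> \<in> (\<Pi>\<^sub>M i\<in>{1..n+1}. N) \<rightarrow>\<^sub>M (\<Pi>\<^sub>M i\<in>{1..n+1}. N)"
  unfolding permute_data_def
proof (rule measurable_restrict)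
  fix i assume "i \<in> {1..n+1}"
  then have "\<pi> i \<in> {1..n+1}" using permutes_in_image[OF assms] by blast
  then show "(\<lambda>z. z (\<pi> i)) \<in> (\<Pi>\<^sub>M i\<in>{1..n+1}. N) \<rightarrow>\<^sub>M N"
    by (rule measurable_component_singleton)
qed

text \<open>The expectation is averaged over the swaps of the test point with each \<open>a\<close>
  in \<open>insert (n+1) F\<close>, which preserve the law. For every \<open>z\<close> the swapped
  values are an antitone function of ranks, and the two rank bounds control their sum.\<close>

lemma expectation_fold_pval_le:
  fixes \<alpha> :: real
  assumes "prob_space \<mu>" and sets_\<mu>: "sets \<mu> = sets (\<Pi>\<^sub>M i\<in>{1..n+1}. MX \<Otimes>\<^sub>M MY)"
    and inv: "\<And>\<pi>. \<pi> permutes {1..n+1} \<Longrightarrow> distr \<mu> \<mu> (permute_data n \<pi>) = \<mu>"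
    and score: "measurable_score MX MY s"
    and F: "F \<subseteq> {1..n}" "F \<noteq> {} \<Longrightarrow> F \<noteq> {1..n}" and "\<alpha> > 0"
  shows "(\<integral>z. max 0 (1 - fold_pval s n (card F) F z / (2 * \<alpha>)) \<partial>\<mu>) \<le> \<alpha>"
proof -
  interpret prob_space \<mu> by fact
  \<comment> \<open>The calibrator expressed in ranks: \<open>r\<close> stands for the p-value
    \<open>r / (card F + 1)\<close>.\<close>
  define g where "g r = max 0 (1 - real r / (2 * \<alpha> * (real (card F) + 1)))" for r
  define e where "e z = max 0 (1 - fold_pval s n (card F) F z / (2 * \<alpha>))" for z
  let ?S = "insert (n+1) F"
  let ?T = "\<lambda>a. permute_data n (Transposition.transpose a (n+1))"
  have finF: "finite F" using F finite_subset by blast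
  have nF: "n+1 \<notin> F" using F by auto
  have cS: "card ?S = card F + 1" using finF nF by simp
  have t: "0 < 2 * \<alpha> * (real (card F) + 1)" using \<open>\<alpha> > 0\<close> by simp
  have "antimono g"
    unfolding g_def using t by (intro antimonoI max.mono diff_left_mono divide_right_mono) auto
  have e_meas: "e \<in> borel_measurable \<mu>"
    unfolding e_def measurable_cong_sets[OF sets_\<mu> refl]
    by (intro borel_measurable_max borel_measurable_diff borel_measurable_divide
        measurable_fold_pval[OF score F] borel_measurable_const)
  have e_int: "integrable \<mu> e"
    by (rule integrable_const_bound[of _ 1])
      (use \<open>\<alpha> > 0\<close> e_meas in \<open>auto simp: e_def fold_pval_nonneg\<close>)
  have perm: "Transposition.transpose a (n+1) permutes {1..n+1}" if "a \<in> ?S" for a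
    using that F by (intro permutes_swap_id) auto
  have T_meas: "?T a \<in> \<mu> \<rightarrow>\<^sub>M \<mu>" if "a \<in> ?S" for a
    using measurable_permute_data[OF perm[OF that]]
    by (simp only: measurable_cong_sets[OF sets_\<mu> sets_\<mu>])
  have eT: "e (?T a z) = g (card {j\<in>?S. s (z a) (dataset z ({1..n} - F)) \<le> s (z j) (dataset z ({1..n} - F))})"
    if "a \<in> ?S" for a z
    unfolding e_def g_def permute_data_def fold_pval_transpose[OF F(1) that] by (simp add: mult_ac)
  have int_T: "integrable \<mu> (\<lambda>z. e (?T a z))" if "a \<in> ?S" for a
    using e_int inv[OF perm[OF that]] integrable_distr[OF T_meas[OF that], of e] by simp
  have exp_T: "(\<integral>z. e (?T a z) \<partial>\<mu>) = (\<integral>z. e z \<partial>\<mu>)" if "a \<in> ?S" for a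
    using integral_distr[OF T_meas[OF that] e_meas] inv[OF perm[OF that]] by simp
  have "(real (card F) + 1) * (\<integral>z. e z \<partial>\<mu>) = (\<Sum>a\<in>?S. \<integral>z. e z \<partial>\<mu>)"
    using cS by simp
  also have "\<dots> = (\<Sum>a\<in>?S. \<integral>z. e (?T a z) \<partial>\<mu>)"
    by (intro sum.cong refl exp_T[symmetric])
  also have "\<dots> = (\<integral>z. (\<Sum>a\<in>?S. e (?T a z)) \<partial>\<mu>)"
    by (intro Bochner_Integration.integral_sum[symmetric] int_T)
  also have "\<dots> \<le> (\<integral>z. \<alpha> * (real (card F) + 1) \<partial>\<mu>)"
  proof (rule integral_mono)
    show "integrable \<mu> (\<lambda>z. \<Sum>a\<in>?S. e (?T a z))"
      by (intro Bochner_Integration.integrable_sum int_T)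
    fix z
    have "(\<Sum>a\<in>?S. e (?T a z)) = (\<Sum>a\<in>?S. g (card {j\<in>?S.
        s (z a) (dataset z ({1..n} - F)) \<le> s (z j) (dataset z ({1..n} - F))}))"
      by (intro sum.cong refl eT)
    also have "\<dots> \<le> (\<Sum>r=1..card ?S. g r)"
      by (rule sum_antimono_rank_le) (use finF \<open>antimono g\<close> in auto)
    also have "\<dots> \<le> 2 * \<alpha> * (real (card F) + 1) / 2"
      unfolding g_def by (rule sum_pos_part_linear_le[OF t])
    finally show "(\<Sum>a\<in>?S. e (?T a z)) \<le> \<alpha> * (real (card F) + 1)" by simp
  qed simp
  also have "\<dots> = (real (card F) + 1) * \<alpha>" by (simp add: prob_space)
  finally show ?thesis
    by (simp add: e_def)
qed

section \<open>Miscoverage for fixed folds\<close>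

text \<open>The witness is an involution: a bijection from \<open>A\<close> to \<open>B\<close>, its
  inverse on \<open>B\<close>, and the identity elsewhere.\<close>

lemma exists_permutes_swapping:
  assumes "finite A" "finite B" "card A = card B" "A \<inter> B = {}" "A \<subseteq> S" "B \<subseteq> S"
  obtains \<pi> where "\<pi> permutes S" "\<pi> ` A = B" "\<pi> ` B = A" "\<And>x. x \<notin> A \<union> B \<Longrightarrow> \<pi> x = x"
proof -
  obtain h where h: "bij_betw h A B"
    using assms finite_same_card_bij by blast
  define h' where "h' = inv_into A h"
  have h': "bij_betw h' B A" unfolding h'_def by (rule bij_betw_inv_into[OF h])
  define \<pi> where "\<pi> x = (if x \<in> A then h x else if x \<in> B then h' x else x)" for x
  have hh': "h' (h x) = x" if "x \<in> A" for x
    using that h by (simp add: h'_def bij_betw_inv_into_left)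
  have h'h: "h (h' x) = x" if "x \<in> B" for x
    using that h by (simp add: h'_def bij_betw_inv_into_right)
  have mem: "x \<in> A \<Longrightarrow> h x \<in> B" "x \<in> B \<Longrightarrow> h' x \<in> A" for x
    using h h' bij_betwE by blast+
  have inv: "\<pi> (\<pi> x) = x" for x
    using mem hh' h'h assms(4) by (auto simp: \<pi>_def)
  have A: "\<pi> ` A = B"
    using bij_betw_imp_surj_on[OF h] by (auto simp: \<pi>_def)
  have B: "\<pi> ` B = A"
    using A inv by (metis (no_types, lifting) image_comp image_cong comp_apply image_ident)
  have "\<pi> x = x" if "x \<notin> S" for x using that assms by (auto simp: \<pi>_def)
  then have "\<pi> permutes S"
    unfolding permutes_def using inv by metis
  then show ?thesis using that A B by (auto simp: \<pi>_def)
qed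

text \<open>The quantity compared with \<open>\<alpha>\<close> in the eu set at the true test label,
  as a function of the randomiser, the data including the test point, and the folds.\<close>

definition eu_stat ::
  "('x \<times> 'y \<Rightarrow> ('x \<times> 'y) list \<Rightarrow> real) \<Rightarrow> nat \<Rightarrow> nat \<Rightarrow> (nat \<Rightarrow> nat set) \<Rightarrow> real \<Rightarrow>
    (nat \<Rightarrow> 'x \<times> 'y) \<Rightarrow> real" where
  "eu_stat s n K J u z = min ((1 / (2 - u)) * fold_pval s n (n div K) (J 1) z)
     (MIN l\<in>{1..K}. (1 / real l) * (\<Sum>k=1..l. fold_pval s n (n div K) (J k) z))"

text \<open>With at least two folds of equal size, a nonempty fold cannot exhaust
  \<open>{1..n}\<close>; this is the condition under which its p-value was shown measurable.\<close>

lemma equal_folds_fold: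
  assumes "equal_folds n K J" "K \<ge> 2" "k \<in> {1..K}"
  shows "J k \<subseteq> {1..n}" "card (J k) = n div K" "J k \<noteq> {} \<Longrightarrow> J k \<noteq> {1..n}"
proof -
  show sub: "J k \<subseteq> {1..n}" and c: "card (J k) = n div K"
    using assms unfolding equal_folds_def by blast+
  assume "J k \<noteq> {}"
  then have "n \<noteq> 0" using sub by auto
  then have "n div K < n" using assms(2) by simp
  then show "J k \<noteq> {1..n}" using c by auto
qed

text \<open>For given \<open>z\<close> the probability over \<open>u\<close> is at most 1 on
  \<open>B\<close> and at most \<open>2 * f 1 z\<close> off \<open>B\<close>. Integrating, the
  Markov inequality pays for \<open>B\<close> with the part of \<open>2 * f 1\<close> that lies on
  \<open>B\<close>, and the total is at most twice the expectation of \<open>f 1\<close>.\<close>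

lemma eu_stat_fixed_folds:
  fixes \<alpha> :: real
  assumes "prob_space \<mu>" and sets_\<mu>: "sets \<mu> = sets (\<Pi>\<^sub>M i\<in>{1..n+1}. MX \<Otimes>\<^sub>M MY)"
    and inv: "\<And>\<pi>. \<pi> permutes {1..n+1} \<Longrightarrow> distr \<mu> \<mu> (permute_data n \<pi>) = \<mu>"
    and score: "measurable_score MX MY s" "symmetric_score MX MY s"
    and J: "equal_folds n K J" and K: "K \<ge> 2" and "\<alpha> > 0"
  shows "(\<integral>\<^sup>+z. emeasure (uniform_measure lborel {0<..<1}) {u. eu_stat s n K J u z \<le> \<alpha>} \<partial>\<mu>)
    \<le> ennreal (2 * \<alpha>)"
proof -
  interpret prob_space \<mu> by fact
  let ?m = "n div K"
  note J_fold = equal_folds_fold[OF J K]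
  define p where "p k z = fold_pval s n ?m (J k) z" for k z
  \<comment> \<open>\<open>f k / \<alpha>\<close> is an e-value calibrated from the p-value \<open>p k\<close>.\<close>
  define f where "f k z = max 0 (1 - p k z / (2 * \<alpha>))" for k z
  \<comment> \<open>The threshold 1/2 is the value of \<open>1 - p / (2 * \<alpha>)\<close> at
    \<open>p = \<alpha>\<close>.\<close>
  define B where "B = {z\<in>space \<mu>. \<exists>l\<in>{1..K}. 1/2 \<le> (1 / real l) * (\<Sum>k=1..l. f k z)}"
  have f_meas: "f k \<in> borel_measurable \<mu>" if "k \<in> {1..K}" for k
    unfolding f_def p_def measurable_cong_sets[OF sets_\<mu> refl]
    by (intro borel_measurable_max borel_measurable_diff borel_measurable_divide
        measurable_fold_pval[OF score(1) J_fold(1,3)[OF that]] borel_measurable_const)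
  have f_int: "integrable \<mu> (f k)" if "k \<in> {1..K}" for k
    by (rule integrable_const_bound[of _ 1])
      (use \<open>\<alpha> > 0\<close> f_meas[OF that] in \<open>auto simp: f_def p_def fold_pval_nonneg\<close>)
  have one: "1 \<in> {1..K}" using K by auto
  have exp_f: "(\<integral>z. f 1 z \<partial>\<mu>) \<le> \<alpha>"
    unfolding f_def p_def J_fold(2)[OF one, symmetric]
    by (rule expectation_fold_pval_le[OF \<open>prob_space \<mu>\<close> sets_\<mu> inv score(1) J_fold(1,3)[OF one] \<open>\<alpha> > 0\<close>])
  have B_sets: "B \<in> sets \<mu>"
  proof -
    have "(\<lambda>z. (1 / real l) * (\<Sum>k=1..l. f k z)) \<in> borel_measurable \<mu>" if "l \<in> {1..K}" for l
      using that by (intro borel_measurable_times borel_measurable_sum f_meas) auto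
    then show ?thesis unfolding B_def
      by (intro sets.sets_Collect_finite_Ex borel_measurable_le) auto
  qed
  have markov: "1/2 * prob B \<le> (\<integral>z. f 1 z * indicator B z \<partial>\<mu>)"
    unfolding B_def
  proof (rule exchangeable_markov[OF f_int])
    fix j assume j: "j \<in> {1..K}"
    \<comment> \<open>Folds 1 and \<open>j\<close> have equal size, so a permutation of the training
      indices can interchange them and fix all other folds pointwise.\<close>
    obtain \<pi> where \<pi>: "\<pi> permutes {1..n}"
      and \<pi>J: "\<And>k. k \<in> {1..K} \<Longrightarrow> \<pi> ` J k = J (Transposition.transpose 1 j k)"
    proof (cases "j = 1")
      case True
      then show ?thesis using that[of id] by (simp add: permutes_id)
    next
      case False
      have disj: "J a \<inter> J b = {}" if "a \<in> {1..K}" "b \<in> {1..K}" "a \<noteq> b" for a b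
        using J that unfolding equal_folds_def disjoint_family_on_def by blast
      have fin: "finite (J a)" if "a \<in> {1..K}" for a
        using J_fold(1)[OF that] finite_subset by blast
      obtain \<pi> where \<pi>: "\<pi> permutes {1..n}" "\<pi> ` J 1 = J j" "\<pi> ` J j = J 1"
          "\<And>x. x \<notin> J 1 \<union> J j \<Longrightarrow> \<pi> x = x"
        using exists_permutes_swapping[OF fin[OF one] fin[OF j] _
          disj[OF one j False[symmetric]] J_fold(1)[OF one] J_fold(1)[OF j]]
          J_fold(2)[OF one] J_fold(2)[OF j] by metis
      have "\<pi> ` J k = J (Transposition.transpose 1 j k)" if k: "k \<in> {1..K}" for k
      proof -
        consider "k = 1" | "k = j" | "k \<noteq> 1" "k \<noteq> j" by blast
        then show ?thesis
        proof cases
          case 3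
          then have "\<pi> x = x" if "x \<in> J k" for x
            using that disj[OF k one] disj[OF k j] \<pi>(4) by blast
          then have "\<pi> ` J k = J k" by (simp cong: image_cong)
          then show ?thesis using 3 by (simp add: Transposition.transpose_def)
        qed (use \<pi> in simp_all)
      qed
      then show ?thesis using that \<pi>(1) by blast
    qed
    have \<pi>': "\<pi> permutes {1..n+1}" by (rule permutes_subset[OF \<pi>]) auto
    show "\<exists>T\<in>\<mu> \<rightarrow>\<^sub>M \<mu>. distr \<mu> \<mu> T = \<mu> \<and>
        (\<forall>z\<in>space \<mu>. \<forall>k\<in>{1..K}. f k (T z) = f (Transposition.transpose 1 j k) z)"
    proof (intro bexI[of _ "permute_data n \<pi>"] conjI ballI)
      show "distr \<mu> \<mu> (permute_data n \<pi>) = \<mu>" by (rule inv[OF \<pi>'])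
      show "permute_data n \<pi> \<in> \<mu> \<rightarrow>\<^sub>M \<mu>"
        using measurable_permute_data[OF \<pi>'] by (simp only: measurable_cong_sets[OF sets_\<mu> sets_\<mu>])
      fix z k assume "z \<in> space \<mu>" and k: "k \<in> {1..K}"
      then have z: "z \<in> space (\<Pi>\<^sub>M i\<in>{1..n+1}. MX \<Otimes>\<^sub>M MY)"
        by (simp only: sets_eq_imp_space_eq[OF sets_\<mu>])
      show "f k (permute_data n \<pi> z) = f (Transposition.transpose 1 j k) z"
        unfolding f_def p_def permute_data_def
        by (simp only: fold_pval_permute[OF score(2) z \<pi> J_fold(1)[OF k]] \<pi>J[OF k])
    qed
  qed
  \<comment> \<open>The right side equals 1 on \<open>B\<close> and \<open>2 * f 1 z\<close> off
    \<open>B\<close>, written so that its integral splits into the terms of \<open>markov\<close>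
    and \<open>exp_f\<close>.\<close>
  have pointwise: "emeasure (uniform_measure lborel {0<..<1}) {u. eu_stat s n K J u z \<le> \<alpha>}
      \<le> ennreal (indicator B z + 2 * f 1 z - 2 * (f 1 z * indicator B z))" if z: "z \<in> space \<mu>" for z
  proof (cases "z \<in> B")
    case True
    interpret U: prob_space "uniform_measure lborel {0<..<1::real}"
      by (rule prob_space_uniform_measure) auto
    show ?thesis using True U.emeasure_le_1 by simp
  next
    case False
    \<comment> \<open>Values of \<open>u\<close> outside the open unit interval are null; inside it
      \<open>2 - u\<close> is positive and may be multiplied out.\<close>
    have "{u. eu_stat s n K J u z \<le> \<alpha>} \<subseteq> - {0<..<1} \<union> {..2 * f 1 z}"
    proof
      fix u assume "u \<in> {u. eu_stat s n K J u z \<le> \<alpha>}"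
      then have "(1 / (2 - u)) * p 1 z \<le> \<alpha> \<or> (MIN l\<in>{1..K}. (1 / real l) * (\<Sum>k=1..l. p k z)) \<le> \<alpha>"
        by (auto simp: eu_stat_def p_def min_le_iff_disj)
      moreover have "\<not> (MIN l\<in>{1..K}. (1 / real l) * (\<Sum>k=1..l. p k z)) \<le> \<alpha>"
      proof
        assume "(MIN l\<in>{1..K}. (1 / real l) * (\<Sum>k=1..l. p k z)) \<le> \<alpha>"
        then obtain l where l: "l \<in> {1..K}" "(1 / real l) * (\<Sum>k=1..l. p k z) \<le> \<alpha>"
          using one by (subst (asm) Min_le_iff) auto
        \<comment> \<open>The affine part of the calibrator commutes with averaging and the positive
          part only increases it, so a running average of p-values at most \<open>\<alpha>\<close>
          would put \<open>z\<close> in \<open>B\<close>.\<close>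
        have "1/2 = 1 - \<alpha> / (2 * \<alpha>)" using \<open>\<alpha> > 0\<close> by simp
        also have "\<dots> \<le> 1 - ((1 / real l) * (\<Sum>k=1..l. p k z)) / (2 * \<alpha>)"
          by (intro diff_left_mono divide_right_mono l(2)) (use \<open>\<alpha> > 0\<close> in simp)
        also have "\<dots> = (1 / real l) * (\<Sum>k=1..l. 1 - p k z / (2 * \<alpha>))"
          using l(1) by (simp add: sum_subtractf sum_divide_distrib[symmetric] right_diff_distrib)
        also have "\<dots> \<le> (1 / real l) * (\<Sum>k=1..l. f k z)"
          by (intro mult_left_mono sum_mono) (auto simp: f_def)
        finally show False using False z l(1) by (auto simp: B_def)
      qed
      ultimately have "(1 / (2 - u)) * p 1 z \<le> \<alpha>" by blast
      then have "u \<le> 2 * f 1 z" if "0 < u" "u < 1"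
      proof -
        have "p 1 z \<le> \<alpha> * (2 - u)" using \<open>(1 / (2 - u)) * p 1 z \<le> \<alpha>\<close> that by (simp add: field_simps)
        then have "u / 2 \<le> 1 - p 1 z / (2 * \<alpha>)" using \<open>\<alpha> > 0\<close> by (simp add: field_simps)
        also have "\<dots> \<le> f 1 z" by (simp add: f_def)
        finally show ?thesis by simp
      qed
      then show "u \<in> - {0<..<1} \<union> {..2 * f 1 z}" by auto
    qed
    then have "emeasure (uniform_measure lborel {0<..<1}) {u. eu_stat s n K J u z \<le> \<alpha>}
        \<le> emeasure (uniform_measure lborel {0<..<1}) (- {0<..<1} \<union> {..2 * f 1 z})"
      by (rule emeasure_mono) auto
    also have "\<dots> = emeasure lborel ({0<..<1} \<inter> (- {0<..<1} \<union> {..2 * f 1 z}))"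
      by (subst emeasure_uniform_measure) (auto simp: divide_ennreal_def)
    also have "\<dots> \<le> emeasure lborel {0..2 * f 1 z}"
      by (rule emeasure_mono) auto
    also have "\<dots> = ennreal (2 * f 1 z)"
      by (subst emeasure_lborel_Icc) (auto simp: f_def)
    finally show ?thesis using False by simp
  qed
  have int_fB: "integrable \<mu> (\<lambda>z. f 1 z * indicator B z)"
    using integrable_real_mult_indicator[OF B_sets f_int[OF one]] by simp
  have int_B: "integrable \<mu> (indicator B :: _ \<Rightarrow> real)"
    using integrable_real_mult_indicator[OF B_sets integrable_const[of 1]] by simp
  have "(\<integral>\<^sup>+z. emeasure (uniform_measure lborel {0<..<1}) {u. eu_stat s n K J u z \<le> \<alpha>} \<partial>\<mu>)
      \<le> (\<integral>\<^sup>+z. ennreal (indicator B z + 2 * f 1 z - 2 * (f 1 z * indicator B z)) \<partial>\<mu>)"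
    by (rule nn_integral_mono) (rule pointwise)
  also have "\<dots> = ennreal (\<integral>z. indicator B z + 2 * f 1 z - 2 * (f 1 z * indicator B z) \<partial>\<mu>)"
    by (rule nn_integral_eq_integral)
      (intro Bochner_Integration.integrable_diff Bochner_Integration.integrable_add
        integrable_mult_right int_fB int_B f_int[OF one],
       auto simp: f_def indicator_def)
  also have "(\<integral>z. indicator B z + 2 * f 1 z - 2 * (f 1 z * indicator B z) \<partial>\<mu>) =
      prob B + 2 * (\<integral>z. f 1 z \<partial>\<mu>) - 2 * (\<integral>z. f 1 z * indicator B z \<partial>\<mu>)"
    using B_sets int_fB int_B f_int[OF one]
    by (subst Bochner_Integration.integral_diff, simp, simp,
        subst Bochner_Integration.integral_add, simp, simp, simp)
  also have "\<dots> \<le> 2 * \<alpha>" using markov exp_f by simp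
  finally show ?thesis by (simp add: ennreal_leI)
qed

section \<open>Joint measurability of the miscoverage event\<close>

text \<open>A finite disjunction in place of the minima reduces measurability to single
  inequalities.\<close>

lemma eu_stat_le_iff:
  assumes "K \<ge> 1"
  shows "eu_stat s n K J u z \<le> \<alpha> \<longleftrightarrow>
    (1 / (2 - u)) * fold_pval s n (n div K) (J 1) z \<le> \<alpha> \<or>
    (\<exists>l\<in>{1..K}. (1 / real l) * (\<Sum>k=1..l. fold_pval s n (n div K) (J k) z) \<le> \<alpha>)"
proof -
  have "{1..K} \<noteq> {}" using assms by simp
  then show ?thesis
    unfolding eu_stat_def min_le_iff_disj by (subst Min_le_iff) auto
qed

text \<open>The fold space is discrete and finite, so it suffices to treat each fixed
  \<open>J\<close>. The conjunct \<open>equal_folds\<close> makes the event empty for those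
  \<open>J\<close> that are not fold systems.\<close>

lemma pred_eu_stat_le:
  assumes score: "measurable_score MX MY s" and K: "K \<ge> 2"
  shows "Measurable.pred (borel \<Otimes>\<^sub>M ((\<Pi>\<^sub>M i\<in>{1..n+1}. MX \<Otimes>\<^sub>M MY) \<Otimes>\<^sub>M fold_space n K))
    (\<lambda>(u, z, J). equal_folds n K J \<and> eu_stat s n K J u z \<le> \<alpha>)"
proof -
  let ?P = "\<Pi>\<^sub>M i\<in>{1..n+1}. MX \<Otimes>\<^sub>M MY"
  let ?C = "{1..K} \<rightarrow>\<^sub>E Pow {1..n}"
  have FS: "fold_space n K = count_space ?C"
    unfolding fold_space_def by (rule count_space_PiM_finite) (auto intro: countable_finite)
  have "countable ?C" by (intro countable_finite finite_PiE) auto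
  have fixed: "Measurable.pred (borel \<Otimes>\<^sub>M ?P) (\<lambda>(u, z). equal_folds n K J \<and> eu_stat s n K J u z \<le> \<alpha>)" for J
  proof (cases "equal_folds n K J")
    case True
    note J_fold = equal_folds_fold[OF True K]
    have p: "(\<lambda>x. fold_pval s n (n div K) (J k) (snd x)) \<in> borel_measurable (borel \<Otimes>\<^sub>M ?P)"
      if "k \<in> {1..K}" for k
      by (rule measurable_compose[OF measurable_snd measurable_fold_pval[OF score J_fold(1,3)[OF that]]])
    have p1: "(\<lambda>x. (1 / (2 - fst x)) * fold_pval s n (n div K) (J 1) (snd x))
        \<in> borel_measurable ((borel :: real measure) \<Otimes>\<^sub>M ?P)"
      using p[of 1] K by (intro borel_measurable_times borel_measurable_divide) auto
    have pl: "(\<lambda>x. (1 / real l) * (\<Sum>k=1..l. fold_pval s n (n div K) (J k) (snd x)))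
        \<in> borel_measurable ((borel :: real measure) \<Otimes>\<^sub>M ?P)" if "l \<in> {1..K}" for l
      using that by (intro borel_measurable_times borel_measurable_sum p) auto
    have "{x \<in> space ((borel :: real measure) \<Otimes>\<^sub>M ?P).
        (1 / (2 - fst x)) * fold_pval s n (n div K) (J 1) (snd x) \<le> \<alpha> \<or>
        (\<exists>l\<in>{1..K}. (1 / real l) * (\<Sum>k=1..l. fold_pval s n (n div K) (J k) (snd x)) \<le> \<alpha>)}
      \<in> sets (borel \<Otimes>\<^sub>M ?P)"
      by (intro sets.sets_Collect_disj sets.sets_Collect_finite_Ex borel_measurable_le p1 pl
          borel_measurable_const) auto
    then show ?thesis
      using True K by (simp add: pred_def eu_stat_le_iff split_beta)
  qed simp
  \<comment> \<open>The discrete coordinate is moved to the front, where the countable-product rule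
    expects it.\<close>
  have "(\<lambda>(J, u, z). equal_folds n K J \<and> eu_stat s n K J u z \<le> \<alpha>)
      \<in> count_space ?C \<Otimes>\<^sub>M (borel \<Otimes>\<^sub>M ?P) \<rightarrow>\<^sub>M count_space UNIV"
    by (rule measurable_pair_measure_countable1[OF \<open>countable ?C\<close>]) (use fixed in simp)
  moreover have "(\<lambda>(u, z, J). (J, u, z)) \<in>
      (borel :: real measure) \<Otimes>\<^sub>M (?P \<Otimes>\<^sub>M fold_space n K) \<rightarrow>\<^sub>M count_space ?C \<Otimes>\<^sub>M (borel \<Otimes>\<^sub>M ?P)"
    unfolding FS by measurable
  ultimately show ?thesis
    using measurable_compose[of "\<lambda>(u, z, J). (J, u, z)" _ _
        "\<lambda>(J, u, z). equal_folds n K J \<and> eu_stat s n K J u z \<le> \<alpha>"]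
    by (simp add: split_beta)
qed

section \<open>Relation of the statistic to the prediction sets, and their nesting\<close>

lemma equal_folds_cong:
  assumes "\<And>k. k \<in> {1..K} \<Longrightarrow> J k = J' k"
  shows "equal_folds n K J \<longleftrightarrow> equal_folds n K J'"
  using assms by (simp add: equal_folds_def disjoint_family_on_def)

text \<open>Used to replace folds and data by their restrictions under \<open>joint\<close>, which
  agree with them on the relevant indices.\<close>

lemma eu_stat_cong:
  assumes J: "equal_folds n K J" and K: "K \<ge> 2"
    and "\<And>k. k \<in> {1..K} \<Longrightarrow> J k = J' k" "\<And>i. i \<in> {1..n+1} \<Longrightarrow> z i = z' i"
  shows "eu_stat s n K J u z = eu_stat s n K J' u z'"
proof -
  have p: "fold_pval s n (n div K) (J k) z = fold_pval s n (n div K) (J' k) z'" if "k \<in> {1..K}" for k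
    using fold_pval_cong[OF equal_folds_fold(1)[OF J K that] assms(4)] assms(3)[OF that] by simp
  have "(\<Sum>k=1..l. fold_pval s n (n div K) (J k) z) = (\<Sum>k=1..l. fold_pval s n (n div K) (J' k) z')"
    if "l \<in> {1..K}" for l
    using that by (intro sum.cong refl p) auto
  then have "(\<lambda>l. (1 / real l) * (\<Sum>k=1..l. fold_pval s n (n div K) (J k) z)) ` {1..K} =
      (\<lambda>l. (1 / real l) * (\<Sum>k=1..l. fold_pval s n (n div K) (J' k) z')) ` {1..K}"
    by (intro image_cong refl) (simp only:)
  moreover have "fold_pval s n (n div K) (J 1) z = fold_pval s n (n div K) (J' 1) z'"
    by (rule p) (use K in simp)
  ultimately show ?thesis unfolding eu_stat_def by (simp only:)
qed

lemma mem_eu_mod_cross_set_iff: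
  assumes J: "equal_folds n K J" and K: "K \<ge> 2" and z: "z (n+1) = (x, y)"
  shows "y \<in> eu_mod_cross_set MY s n K \<alpha> J u z x \<longleftrightarrow> y \<in> space MY \<and> \<not> eu_stat s n K J u z \<le> \<alpha>"
proof -
  have p: "cross_pval s n K J z x k y = fold_pval s n (n div K) (J k) z" if "k \<in> {1..K}" for k
    by (rule cross_pval_eq_fold_pval[where z = z and x = x and y = y, OF J that z])
  have "(\<Sum>k=1..l. cross_pval s n K J z x k y) = (\<Sum>k=1..l. fold_pval s n (n div K) (J k) z)"
    if "l \<in> {1..K}" for l
    using that by (intro sum.cong refl p) auto
  then have "(\<lambda>l. (1 / real l) * (\<Sum>k=1..l. cross_pval s n K J z x k y)) ` {1..K} =
      (\<lambda>l. (1 / real l) * (\<Sum>k=1..l. fold_pval s n (n div K) (J k) z)) ` {1..K}"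
    by (intro image_cong refl) (simp only:)
  moreover have "cross_pval s n K J z x 1 y = fold_pval s n (n div K) (J 1) z"
    by (rule p) (use K in simp)
  ultimately show ?thesis
    unfolding eu_mod_cross_set_def eu_stat_def mem_Collect_eq not_le by (simp only:)
qed

lemma eu_mod_cross_set_subset: "eu_mod_cross_set MY s n K \<alpha> J u z x \<subseteq> e_mod_cross_set MY s n K \<alpha> J z x"
  by (auto simp: eu_mod_cross_set_def e_mod_cross_set_def)

text \<open>The full average is the running average at \<open>l = K\<close>.\<close>

lemma e_mod_cross_set_subset:
  assumes "K \<ge> 1"
  shows "e_mod_cross_set MY s n K \<alpha> J z x \<subseteq> mod_cross_set MY s n K \<alpha> J z x"
proof
  fix y assume y: "y \<in> e_mod_cross_set MY s n K \<alpha> J z x"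
  have "(MIN l\<in>{1..K}. (1 / real l) * (\<Sum>k=1..l. cross_pval s n K J z x k y))
      \<le> (1 / real K) * (\<Sum>k=1..K. cross_pval s n K J z x k y)"
    by (rule Min_le) (use assms in auto)
  then show "y \<in> mod_cross_set MY s n K \<alpha> J z x"
    using y by (auto simp: mod_cross_set_def e_mod_cross_set_def)
qed

section \<open>Nesting, and coverage with random folds\<close>

theorem theorem4p7:
  fixes M :: "'w measure" and MX :: "'x measure" and MY :: "'y measure"
    and X :: "nat \<Rightarrow> 'w \<Rightarrow> 'x" and Y :: "nat \<Rightarrow> 'w \<Rightarrow> 'y"
    and I :: "nat \<Rightarrow> 'w \<Rightarrow> nat set" and U :: "'w \<Rightarrow> real"
    and s :: "'x \<times> 'y \<Rightarrow> ('x \<times> 'y) list \<Rightarrow> real"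
    and n K :: nat and \<alpha> :: real
  defines "Z \<equiv> (\<lambda>i \<omega>. (X i \<omega>, Y i \<omega>))"
  assumes "prob_space M"
    and "0 < \<alpha>" and "\<alpha> < 1"
    and "K \<ge> 2" and "K dvd n"
    and "measurable_score MX MY s" and "symmetric_score MX MY s"
    and "\<And>i. i \<in> {1..n+1} \<Longrightarrow> X i \<in> M \<rightarrow>\<^sub>M MX"
    and "\<And>i. i \<in> {1..n+1} \<Longrightarrow> Y i \<in> M \<rightarrow>\<^sub>M MY"
    and "\<And>\<omega>. \<omega> \<in> space M \<Longrightarrow> equal_folds n K (\<lambda>k. I k \<omega>)"
    and "joint {1..K} I \<in> M \<rightarrow>\<^sub>M fold_space n K"
    and "indep_rvs M
           (\<Pi>\<^sub>M i\<in>{1..n+1}. MX \<Otimes>\<^sub>M MY) (joint {1..n+1} Z)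
           (fold_space n K) (joint {1..K} I)"
    and "U \<in> borel_measurable M"
    and "distr M lborel U = uniform_measure lborel {0<..<1}"
    and "indep_rvs M
           borel U
           ((\<Pi>\<^sub>M i\<in>{1..n+1}. MX \<Otimes>\<^sub>M MY) \<Otimes>\<^sub>M fold_space n K)
           (\<lambda>\<omega>. (joint {1..n+1} Z \<omega>, joint {1..K} I \<omega>))"
  shows "(\<forall>\<omega>\<in>space M.
            eu_mod_cross_set MY s n K \<alpha> (\<lambda>k. I k \<omega>) (U \<omega>) (\<lambda>i. Z i \<omega>) (X (n+1) \<omega>)
              \<subseteq> e_mod_cross_set MY s n K \<alpha> (\<lambda>k. I k \<omega>) (\<lambda>i. Z i \<omega>) (X (n+1) \<omega>) \<and>
            e_mod_cross_set MY s n K \<alpha> (\<lambda>k. I k \<omega>) (\<lambda>i. Z i \<omega>) (X (n+1) \<omega>)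
              \<subseteq> mod_cross_set MY s n K \<alpha> (\<lambda>k. I k \<omega>) (\<lambda>i. Z i \<omega>) (X (n+1) \<omega>)) \<and>
         (exchangeable M (MX \<Otimes>\<^sub>M MY) {1..n+1} Z \<longrightarrow>
            measure M {\<omega> \<in> space M.
              Y (n+1) \<omega> \<in>
                eu_mod_cross_set MY s n K \<alpha> (\<lambda>k. I k \<omega>) (U \<omega>) (\<lambda>i. Z i \<omega>) (X (n+1) \<omega>)}
            \<ge> 1 - 2 * \<alpha>)"
proof (intro conjI ballI impI)
  fix \<omega> assume "\<omega> \<in> space M"
  show "eu_mod_cross_set MY s n K \<alpha> (\<lambda>k. I k \<omega>) (U \<omega>) (\<lambda>i. Z i \<omega>) (X (n+1) \<omega>)
      \<subseteq> e_mod_cross_set MY s n K \<alpha> (\<lambda>k. I k \<omega>) (\<lambda>i. Z i \<omega>) (X (n+1) \<omega>)"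
    by (rule eu_mod_cross_set_subset)
  show "e_mod_cross_set MY s n K \<alpha> (\<lambda>k. I k \<omega>) (\<lambda>i. Z i \<omega>) (X (n+1) \<omega>)
      \<subseteq> mod_cross_set MY s n K \<alpha> (\<lambda>k. I k \<omega>) (\<lambda>i. Z i \<omega>) (X (n+1) \<omega>)"
    by (rule e_mod_cross_set_subset) (use \<open>K \<ge> 2\<close> in simp)
next
  assume exch: "exchangeable M (MX \<Otimes>\<^sub>M MY) {1..n+1} Z"
  interpret prob_space M by fact
  let ?P = "\<Pi>\<^sub>M i\<in>{1..n+1}. MX \<Otimes>\<^sub>M MY"
  let ?FS = "fold_space n K"
  let ?V = "uniform_measure lborel {0<..<1::real}"
  define z where "z = joint {1..n+1} Z"
  define J where "J = joint {1..K} I"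
  define \<mu> where "\<mu> = distr M ?P z"
  define \<nu> where "\<nu> = distr M ?FS J"
  have z_meas[measurable]: "z \<in> M \<rightarrow>\<^sub>M ?P" and J_meas[measurable]: "J \<in> M \<rightarrow>\<^sub>M ?FS"
    using assms(13) by (simp_all add: indep_rvs_def z_def J_def)
  have sets_\<mu>: "sets \<mu> = sets ?P" by (simp add: \<mu>_def)
  have prob_\<mu>: "prob_space \<mu>" and prob_\<nu>: "prob_space \<nu>"
    unfolding \<mu>_def \<nu>_def by (rule prob_space_distr[OF z_meas], rule prob_space_distr[OF J_meas])
  \<comment> \<open>Exchangeability of the random elements becomes invariance of their joint law
    under coordinate permutations.\<close>
  have inv: "distr \<mu> \<mu> (permute_data n \<pi>) = \<mu>" if \<pi>: "\<pi> permutes {1..n+1}" for \<pi>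
  proof -
    have "permute_data n \<pi> (z \<omega>) = joint {1..n+1} (\<lambda>i. Z (\<pi> i)) \<omega>" for \<omega>
      using permutes_in_image[OF \<pi>]
      by (auto simp: permute_data_def z_def joint_def restrict_def fun_eq_iff)
    then have "distr \<mu> ?P (permute_data n \<pi>) = distr M ?P (joint {1..n+1} (\<lambda>i. Z (\<pi> i)))"
      unfolding \<mu>_def by (subst distr_distr[OF measurable_permute_data[OF \<pi>] z_meas]) (simp add: o_def)
    also have "\<dots> = \<mu>"
      using exch \<pi> by (simp add: exchangeable_def \<mu>_def z_def)
    finally show ?thesis by (simp cong: distr_cong add: sets_\<mu>)
  qed
  have U_distr: "distr M borel U = ?V"
    unfolding assms(15)[symmetric] by (rule distr_cong) auto
  \<comment> \<open>Independence of \<open>U\<close> from data and folds, then of the data from the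
    folds, gives a threefold product law.\<close>
  have W_distr: "distr M (borel \<Otimes>\<^sub>M (?P \<Otimes>\<^sub>M ?FS)) (\<lambda>\<omega>. (U \<omega>, z \<omega>, J \<omega>)) = ?V \<Otimes>\<^sub>M (\<mu> \<Otimes>\<^sub>M \<nu>)"
    unfolding z_def J_def \<mu>_def \<nu>_def indep_rvs_distr_Pair[OF assms(16)] U_distr
      indep_rvs_distr_Pair[OF assms(13)] ..
  have W_meas[measurable]: "(\<lambda>\<omega>. (U \<omega>, z \<omega>, J \<omega>)) \<in> M \<rightarrow>\<^sub>M borel \<Otimes>\<^sub>M (?P \<Otimes>\<^sub>M ?FS)"
    using assms(14) by measurable
  define bad where "bad = {x \<in> space (borel \<Otimes>\<^sub>M (?P \<Otimes>\<^sub>M ?FS)).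
      case x of (u, z, J) \<Rightarrow> equal_folds n K J \<and> eu_stat s n K J u z \<le> \<alpha>}"
  have bad_sets[measurable]: "bad \<in> sets (borel \<Otimes>\<^sub>M (?P \<Otimes>\<^sub>M ?FS))"
    using pred_eu_stat_le[OF assms(7,5), of n \<alpha>] by (simp only: pred_def bad_def)
  interpret V: prob_space ?V by (rule prob_space_uniform_measure) auto
  interpret \<mu>: prob_space \<mu> by (rule prob_\<mu>)
  interpret \<nu>: prob_space \<nu> by (rule prob_\<nu>)
  interpret \<mu>\<nu>: pair_prob_space \<mu> \<nu> ..
  interpret V\<mu>\<nu>: pair_prob_space ?V "\<mu> \<Otimes>\<^sub>M \<nu>" ..
  have bad_sets': "bad \<in> sets (?V \<Otimes>\<^sub>M (\<mu> \<Otimes>\<^sub>M \<nu>))"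
    using bad_sets unfolding W_distr[symmetric] by simp
  \<comment> \<open>For a fold system the section of \<open>bad\<close> is the event bounded for
    fixed folds; for any other \<open>J\<close> it is empty.\<close>
  have inner: "(\<integral>\<^sup>+z. emeasure ?V ((\<lambda>u. (u, z, J)) -` bad) \<partial>\<mu>) \<le> ennreal (2 * \<alpha>)"
    if "J \<in> space \<nu>" for J
  proof (cases "equal_folds n K J")
    case True
    have "(\<lambda>u. (u, z, J)) -` bad = {u. eu_stat s n K J u z \<le> \<alpha>}" if "z \<in> space \<mu>" for z
      using True that \<open>J \<in> space \<nu>\<close> by (auto simp: bad_def space_pair_measure \<mu>_def \<nu>_def)
    then have "(\<integral>\<^sup>+z. emeasure ?V ((\<lambda>u. (u, z, J)) -` bad) \<partial>\<mu>) =
        (\<integral>\<^sup>+z. emeasure ?V {u. eu_stat s n K J u z \<le> \<alpha>} \<partial>\<mu>)"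
      by (intro nn_integral_cong) simp
    also have "\<dots> \<le> ennreal (2 * \<alpha>)"
      by (rule eu_stat_fixed_folds[OF prob_\<mu> sets_\<mu> inv assms(7,8) True assms(5,3)])
    finally show ?thesis .
  next
    case False
    then have "(\<lambda>u. (u, z, J)) -` bad = {}" for z by (auto simp: bad_def)
    then show ?thesis by simp
  qed
  let ?bad = "(\<lambda>\<omega>. (U \<omega>, z \<omega>, J \<omega>)) -` bad \<inter> space M"
  have "emeasure M ?bad = emeasure (?V \<Otimes>\<^sub>M (\<mu> \<Otimes>\<^sub>M \<nu>)) bad"
    unfolding W_distr[symmetric] by (rule emeasure_distr[symmetric]) measurable
  \<comment> \<open>Tonelli with \<open>u\<close> innermost and the folds outermost, so that the
    inner two integrals have fixed folds.\<close>
  also have "\<dots> = (\<integral>\<^sup>+y. emeasure ?V ((\<lambda>u. (u, y)) -` bad) \<partial>(\<mu> \<Otimes>\<^sub>M \<nu>))"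
    by (rule V\<mu>\<nu>.emeasure_pair_measure_alt2[OF bad_sets'])
  also have "\<dots> = (\<integral>\<^sup>+J. \<integral>\<^sup>+z. emeasure ?V ((\<lambda>u. (u, z, J)) -` bad) \<partial>\<mu> \<partial>\<nu>)"
    by (rule \<mu>\<nu>.nn_integral_snd[symmetric]) (rule V\<mu>\<nu>.measurable_emeasure_Pair2[OF bad_sets'])
  also have "\<dots> \<le> (\<integral>\<^sup>+J. ennreal (2 * \<alpha>) \<partial>\<nu>)"
    by (rule nn_integral_mono) (rule inner)
  also have "\<dots> = ennreal (2 * \<alpha>)"
    by (simp add: \<nu>.emeasure_space_1)
  finally have "prob ?bad \<le> 2 * \<alpha>"
    using assms(3) by (simp add: emeasure_eq_measure)
  moreover have "{\<omega> \<in> space M. Y (n+1) \<omega> \<in>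
      eu_mod_cross_set MY s n K \<alpha> (\<lambda>k. I k \<omega>) (U \<omega>) (\<lambda>i. Z i \<omega>) (X (n+1) \<omega>)} = space M - ?bad"
  proof -
    have "Y (n+1) \<omega> \<in> eu_mod_cross_set MY s n K \<alpha> (\<lambda>k. I k \<omega>) (U \<omega>) (\<lambda>i. Z i \<omega>) (X (n+1) \<omega>) \<longleftrightarrow>
        (U \<omega>, z \<omega>, J \<omega>) \<notin> bad" if \<omega>: "\<omega> \<in> space M" for \<omega>
    proof -
      note folds = assms(11)[OF \<omega>]
      have Jk: "I k \<omega> = J \<omega> k" if "k \<in> {1..K}" for k
        using that by (simp add: J_def joint_def)
      have zi: "Z i \<omega> = z \<omega> i" if "i \<in> {1..n+1}" for i
        using that by (simp add: z_def joint_def)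
      have "Y (n+1) \<omega> \<in> space MY"
        using measurable_space[OF assms(10) \<omega>] by simp
      then have "Y (n+1) \<omega> \<in> eu_mod_cross_set MY s n K \<alpha> (\<lambda>k. I k \<omega>) (U \<omega>) (\<lambda>i. Z i \<omega>) (X (n+1) \<omega>)
          \<longleftrightarrow> \<not> eu_stat s n K (\<lambda>k. I k \<omega>) (U \<omega>) (\<lambda>i. Z i \<omega>) \<le> \<alpha>"
        using mem_eu_mod_cross_set_iff[OF folds assms(5), of "\<lambda>i. Z i \<omega>" "X (n+1) \<omega>" "Y (n+1) \<omega>"]
        by (simp add: Z_def)
      also have "eu_stat s n K (\<lambda>k. I k \<omega>) (U \<omega>) (\<lambda>i. Z i \<omega>) = eu_stat s n K (J \<omega>) (U \<omega>) (z \<omega>)"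
        by (rule eu_stat_cong[OF folds assms(5) Jk zi])
      also have "\<not> eu_stat s n K (J \<omega>) (U \<omega>) (z \<omega>) \<le> \<alpha> \<longleftrightarrow> (U \<omega>, z \<omega>, J \<omega>) \<notin> bad"
        using folds equal_folds_cong[of K "\<lambda>k. I k \<omega>" "J \<omega>" n, OF Jk] measurable_space[OF W_meas \<omega>]
        by (simp add: bad_def)
      finally show ?thesis .
    qed
    then show ?thesis by auto
  qed
  moreover have "prob (space M - ?bad) = 1 - prob ?bad"
    by (rule prob_compl) measurable
  ultimately show "measure M {\<omega> \<in> space M. Y (n+1) \<omega> \<in>
      eu_mod_cross_set MY s n K \<alpha> (\<lambda>k. I k \<omega>) (U \<omega>) (\<lambda>i. Z i \<omega>) (X (n+1) \<omega>)} \<ge> 1 - 2 * \<alpha>"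
    by simp
qed

end
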